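(* Let $(X,\Delta)$ be an abstract simplicial complex on a finite ground set $X$ with $|X|=n$. Suppose that for every integer $k$ with $1\le k<\operatorname{rk}(\Delta)$, every vertex of the combinatorial atlas $\mathcal{A}(\Delta,k)$ is hyperbolic. Then $\Delta$ is a matroid, i.e. for all $S,T\in\Delta$ with $|S|<|T|$ there exists $y\in T\setminus S$ with $S\cup\{y\}\in\Delta$.
   Context: An abstract simplicial complex is a pair $(X,\Delta)$ with $\Delta\subseteq 2^X$ such that $S\subset T\in\Delta$ implies $S\in\Delta$; elements of $\Delta$ are faces and $\operatorname{rk}(\Delta)$ is the largest cardinality of a face. $X^*$ is the set of finite words over $X$. A word is feasible if no letter repeats and its set of letters lies in $\Delta$; $\mathcal{L}$ is the set of feasible words. For $\beta\in X^*$, $j\ge0$: $\operatorname{Cnt}_j(\beta)=\{\gamma\in X^*:|\gamma|=j,\ \beta\gamma\in\mathcal{L}\}$. $\bar X=X\cup\{\ast\}$ ($\ast$ a new symbol); vectors/matrices are indexed by $\bar X$. For $\alpha\in X^*$ and $m\ge1$, $\mathbf{A}(\alpha,m)$ is the $\bar X\times\bar X$ matrix with $A_{xy}=|\operatorname{Cnt}_{m-1}(\alpha xy)|$ ($x,y\in X$), $A_{x\ast}=A_{\ast x}=|\operatorname{Cnt}_{m-1}(\alpha x)|$ ($x\in X$), $A_{\ast\ast}=|\operatorname{Cnt}_{m-1}(\alpha)|$. The atlas $\mathcal{A}(\Delta,k)$ has vertices $(\alpha,m,t)$ with $1\le m\le k-1$, $\alpha\in X^*$, $|\alpha|\le k-1-m$,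 $t\in[0,1]$, with associated matrix $t\mathbf{A}(\alpha,m+1)+(1-t)\mathbf{A}(\alpha,m)$, and vertices $(\alpha,0,1)$ with $|\alpha|\le k-1$, with associated matrix $\mathbf{A}(\alpha,1)$. A vertex is hyperbolic if its associated matrix $\mathbf{M}$ satisfies $\langle\mathbf{v},\mathbf{M}\mathbf{w}\rangle^2\ge\langle\mathbf{v},\mathbf{M}\mathbf{v}\rangle\langle\mathbf{w},\mathbf{M}\mathbf{w}\rangle$ for all $\mathbf{v},\mathbf{w}\in\mathbb{R}^{\bar X}$ with $\langle\mathbf{w},\mathbf{M}\mathbf{w}\rangle>0$. *)

theory Defs
  imports Complex_Main
begin

definition simplicial_complex :: "'a set \<Rightarrow> 'a set set \<Rightarrow> bool" where
  "simplicial_complex X \<Delta> \<longleftrightarrow> \<Delta> \<subseteq> Pow X \<and> (\<forall>S T. S \<subset> T \<and> T \<in> \<Delta> \<longrightarrow> S \<in> \<Delta>)"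

text \<open>The value is unspecified when \<open>\<Delta>\<close> has no faces at all.\<close>

definition rk :: "'a set set \<Rightarrow> nat" where
  "rk \<Delta> = Max (card ` \<Delta>)"

definition feasible_words :: "'a set \<Rightarrow> 'a set set \<Rightarrow> 'a list set" where
  "feasible_words X \<Delta> = {w \<in> lists X. distinct w \<and> set w \<in> \<Delta>}"

definition Cnt :: "'a set \<Rightarrow> 'a set set \<Rightarrow> nat \<Rightarrow> 'a list \<Rightarrow> 'a list set" where
  "Cnt X \<Delta> j \<beta> = {\<gamma> \<in> lists X. length \<gamma> = j \<and> \<beta> @ \<gamma> \<in> feasible_words X \<Delta>}"

text \<open>The extra symbol adjoined to \<open>X\<close> is \<open>None\<close>; a letter \<open>x\<close> is \<open>Some x\<close>.\<close>

definition bar :: "'a set \<Rightarrow> 'a option set" where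
  "bar X = insert None (Some ` X)"

text \<open>Vectors and matrices indexed by \<open>bar X\<close> are functions on \<open>'a option\<close>, of which only the
  entries with indices in \<open>bar X\<close> are used.\<close>

type_synonym 'a bvec = "'a option \<Rightarrow> real"
type_synonym 'a bmat = "'a option \<Rightarrow> 'a option \<Rightarrow> real"

definition bar_inner :: "'a set \<Rightarrow> 'a bvec \<Rightarrow> 'a bvec \<Rightarrow> real" where
  "bar_inner X v w = (\<Sum>i\<in>bar X. v i * w i)"

definition bar_mult_vec :: "'a set \<Rightarrow> 'a bmat \<Rightarrow> 'a bvec \<Rightarrow> 'a bvec" where
  "bar_mult_vec X M w = (\<lambda>i. \<Sum>j\<in>bar X. M i j * w j)"

text \<open>Only meaningful for \<open>m \<ge> 1\<close>.\<close>

fun word_matrix :: "'a set \<Rightarrow> 'a set set \<Rightarrow> 'a list \<Rightarrow> nat \<Rightarrow> 'a bmat" where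
  "word_matrix X \<Delta> \<alpha> m (Some x) (Some y) = real (card (Cnt X \<Delta> (m - 1) (\<alpha> @ [x, y])))"
| "word_matrix X \<Delta> \<alpha> m (Some x) None = real (card (Cnt X \<Delta> (m - 1) (\<alpha> @ [x])))"
| "word_matrix X \<Delta> \<alpha> m None (Some x) = real (card (Cnt X \<Delta> (m - 1) (\<alpha> @ [x])))"
| "word_matrix X \<Delta> \<alpha> m None None = real (card (Cnt X \<Delta> (m - 1) \<alpha>))"

text \<open>The bounds \<open>m \<le> k - 1\<close>, \<open>\<bar>\<alpha>\<bar> \<le> k - 1 - m\<close> and \<open>\<bar>\<alpha>\<bar> \<le> k - 1\<close> are written without
  subtraction, which truncates on natural numbers.\<close>

definition atlas_vertices :: "'a set \<Rightarrow> nat \<Rightarrow> ('a list \<times> nat \<times> real) set" where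
  "atlas_vertices X k =
     {(\<alpha>, m, t) | \<alpha> m t. 1 \<le> m \<and> m + 1 \<le> k \<and> \<alpha> \<in> lists X \<and> length \<alpha> + m + 1 \<le> k \<and> t \<in> {0..1}}
   \<union> {(\<alpha>, 0, 1) | \<alpha>. \<alpha> \<in> lists X \<and> length \<alpha> + 1 \<le> k}"

definition vertex_matrix :: "'a set \<Rightarrow> 'a set set \<Rightarrow> 'a list \<times> nat \<times> real \<Rightarrow> 'a bmat" where
  "vertex_matrix X \<Delta> = (\<lambda>(\<alpha>, m, t).
     if m = 0 then word_matrix X \<Delta> \<alpha> 1
     else (\<lambda>i j. t * word_matrix X \<Delta> \<alpha> (m + 1) i j + (1 - t) * word_matrix X \<Delta> \<alpha> m i j))"

definition hyperbolic_matrix :: "'a set \<Rightarrow> 'a bmat \<Rightarrow> bool" where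
  "hyperbolic_matrix X M \<longleftrightarrow>
     (\<forall>v w. bar_inner X w (bar_mult_vec X M w) > 0 \<longrightarrow>
        (bar_inner X v (bar_mult_vec X M w))\<^sup>2
          \<ge> bar_inner X v (bar_mult_vec X M v) * bar_inner X w (bar_mult_vec X M w))"

definition hyperbolic_vertex :: "'a set \<Rightarrow> 'a set set \<Rightarrow> 'a list \<times> nat \<times> real \<Rightarrow> bool" where
  "hyperbolic_vertex X \<Delta> p \<longleftrightarrow> hyperbolic_matrix X (vertex_matrix X \<Delta> p)"

end

theory Submission
  imports Defs
begin

text \<open>Only the vertices \<open>(\<alpha>, 0, 1)\<close> are needed. If \<open>I + x\<close> and \<open>I + y + z\<close> are faces but neither
  \<open>I + x + y\<close> nor \<open>I + x + z\<close> is, let \<open>\<alpha>\<close> be a word listing \<open>I\<close> and \<open>M = A(\<alpha>, 1)\<close>. With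
  \<open>v = e\<^sub>y + e\<^sub>z - e\<^sub>x\<close> and \<open>w\<close> the basis vector of the extra symbol, \<open>\<langle>v, Mw\<rangle> = \<langle>w, Mw\<rangle> = 1\<close> but
  \<open>\<langle>v, Mv\<rangle> = 2\<close>, contradicting hyperbolicity. Hence exchange holds in this local form, and
  induction on \<open>card (S - T)\<close> extends it to arbitrary faces: remove some \<open>x \<in> S - T\<close>, augment twice
  from \<open>T\<close> by \<open>y\<close> and \<open>z\<close>, and apply local exchange to \<open>I = S - {x}\<close>.\<close>

text \<open>The empty word is the only continuation of length 0, so the entries of
  \<open>A(\<alpha>, 1)\<close> are 0/1 indicators of feasibility.\<close>

lemma card_Cnt_0: "card (Cnt X \<Delta> 0 \<beta>) = (if \<beta> \<in> feasible_words X \<Delta> then 1 else 0)"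
proof -
  have "Cnt X \<Delta> 0 \<beta> = (if \<beta> \<in> feasible_words X \<Delta> then {[]} else {})"
    by (auto simp: Cnt_def)
  then show ?thesis by simp
qed

lemma simplicial_complex_subset:
  assumes "simplicial_complex X \<Delta>" "T \<in> \<Delta>" "S \<subseteq> T"
  shows "S \<in> \<Delta>"
  using assms unfolding simplicial_complex_def by blast

lemma finite_bar: "finite X \<Longrightarrow> finite (bar X)"
  by (simp add: bar_def)

lemma sum_bar_support:
  assumes "finite X" "F \<subseteq> bar X" "\<And>i. i \<notin> F \<Longrightarrow> f i = (0::real)"
  shows "(\<Sum>i\<in>bar X. f i) = (\<Sum>i\<in>F. f i)"
  using assms by (intro sum.mono_neutral_right) (auto simp: finite_bar)

text \<open>Restricting to supports turns the forms for the test vectors below into sums of at most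
  nine explicit entries.\<close>

lemma bar_form_support:
  assumes "finite X" "F \<subseteq> bar X" "G \<subseteq> bar X"
    and "\<forall>i. i \<notin> F \<longrightarrow> v i = 0" "\<forall>i. i \<notin> G \<longrightarrow> w i = 0"
  shows "bar_inner X v (bar_mult_vec X M w) = (\<Sum>i\<in>F. v i * (\<Sum>j\<in>G. M i j * w j))"
  unfolding bar_inner_def bar_mult_vec_def
  using assms by (simp add: sum_bar_support[where F = F] sum_bar_support[where F = G])

lemma local_exchange:
  assumes fin: "finite X" and sc: "simplicial_complex X \<Delta>"
    and hyp: "\<And>k::nat. 1 \<le> k \<Longrightarrow> k < rk \<Delta> \<Longrightarrow> \<forall>p\<in>atlas_vertices X k. hyperbolic_vertex X \<Delta> p"
    and notin: "x \<notin> I" "y \<notin> I" "z \<notin> I" and ne: "x \<noteq> y" "x \<noteq> z" "y \<noteq> z"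
    and Ix: "insert x I \<in> \<Delta>" and Iyz: "insert y (insert z I) \<in> \<Delta>"
  shows "insert y (insert x I) \<in> \<Delta> \<or> insert z (insert x I) \<in> \<Delta>"
proof (rule ccontr)
  assume neg: "\<not> ?thesis"
  have sub: "S \<subseteq> X" if "S \<in> \<Delta>" for S
    using sc that by (auto simp: simplicial_complex_def)
  have X: "x \<in> X" "y \<in> X" "z \<in> X" "I \<subseteq> X"
    using sub[OF Ix] sub[OF Iyz] by auto
  have faces: "I \<in> \<Delta>" "insert y I \<in> \<Delta>" "insert z I \<in> \<Delta>"
    using simplicial_complex_subset[OF sc Iyz] by auto
  have finI: "finite I"
    using X(4) fin by (rule finite_subset)
  then obtain \<alpha> where \<alpha>: "set \<alpha> = I" "distinct \<alpha>"
    using finite_distinct_list by blast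
  have "finite \<Delta>"
    using sc fin unfolding simplicial_complex_def by (meson finite_Pow_iff finite_subset)
  then have "card (insert y (insert z I)) \<le> rk \<Delta>"
    unfolding rk_def using Iyz by simp
  \<comment> \<open>The face I + y + z has two more elements than I. Thus k =
    \<open>card I + 1\<close> lies below the rank; it is the least k whose atlas has a vertex with a
    word of length \<open>card I\<close>.\<close>
  then have "card I + 1 < rk \<Delta>"
    using notin ne finI by simp
  moreover have "(\<alpha>, 0, 1) \<in> atlas_vertices X (card I + 1)"
    using \<alpha> X(4) by (auto simp: atlas_vertices_def distinct_card[symmetric])
  ultimately have "hyperbolic_vertex X \<Delta> (\<alpha>, 0, 1)"
    using hyp[of "card I + 1"] by simp
  then have hyperbolic: "hyperbolic_matrix X (word_matrix X \<Delta> \<alpha> 1)"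
    by (simp add: hyperbolic_vertex_def vertex_matrix_def)
  define M where "M = word_matrix X \<Delta> \<alpha> 1"
  define v :: "'a bvec" where
    "v = (\<lambda>i. if i = Some x then -1 else if i = Some y \<or> i = Some z then 1 else 0)"
  define w :: "'a bvec" where "w = (\<lambda>i. if i = None then 1 else 0)"
  let ?F = "{Some x, Some y, Some z}"
  have supp: "?F \<subseteq> bar X" "{None} \<subseteq> bar X"
    "\<forall>i. i \<notin> ?F \<longrightarrow> v i = 0" "\<forall>i. i \<notin> {None} \<longrightarrow> w i = 0"
    using X by (auto simp: bar_def v_def w_def)
  note form = bar_form_support[OF fin]
  have feasible: "\<alpha> @ u \<in> feasible_words X \<Delta> \<longleftrightarrow> distinct u \<and> set u \<inter> I = {} \<and> set u \<union> I \<in> \<Delta>"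
    if "set u \<subseteq> X" for u
    using \<alpha> X(4) that
    by (simp add: feasible_words_def lists_eq_set Un_commute[of I] Int_commute[of I] conj_assoc)
  have M_None: "M None None = 1" "M (Some x) None = 1" "M (Some y) None = 1" "M (Some z) None = 1"
    using feasible[of "[]"] feasible[of "[x]"] feasible[of "[y]"] feasible[of "[z]"]
      X notin faces Ix by (simp_all add: M_def card_Cnt_0)
  \<comment> \<open>Diagonal entries vanish because a repeated letter is infeasible, the others
    because I + x + y and I + x + z are not faces.\<close>
  have M_0: "M (Some x) (Some x) = 0" "M (Some y) (Some y) = 0" "M (Some z) (Some z) = 0"
    "M (Some x) (Some y) = 0" "M (Some y) (Some x) = 0"
    "M (Some x) (Some z) = 0" "M (Some z) (Some x) = 0"
    using neg X by (simp_all add: M_def card_Cnt_0 feasible insert_commute)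
  have M_1: "M (Some y) (Some z) = 1" "M (Some z) (Some y) = 1"
    using Iyz X notin ne by (simp_all add: M_def card_Cnt_0 feasible insert_commute)
  have "bar_inner X w (bar_mult_vec X M w) = 1"
    by (simp only: form[OF supp(2,2,4,4)]) (simp add: w_def M_None)
  moreover have "bar_inner X v (bar_mult_vec X M w) = 1"
    using ne
    by (simp only: form[OF supp(1,2,3,4)]) (simp add: v_def w_def M_None)
  \<comment> \<open>Only the entries at (y, z) and (z, y) contribute. Hyperbolicity would now demand
    1 \<ge> 2.\<close>
  moreover have "bar_inner X v (bar_mult_vec X M v) = 2"
    using ne
    by (simp only: form[OF supp(1,1,3,3)]) (simp add: v_def M_0 M_1)
  ultimately show False
    using hyperbolic[unfolded hyperbolic_matrix_def, rule_format, of w v]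
    by (simp add: M_def)
qed

lemma exchange_if_local_exchange:
  assumes fin: "\<And>S. S \<in> \<Delta> \<Longrightarrow> finite S"
    and down: "\<And>S T. T \<in> \<Delta> \<Longrightarrow> S \<subseteq> T \<Longrightarrow> S \<in> \<Delta>"
    and exch: "\<And>I x y z. \<lbrakk>x \<notin> I; y \<notin> I; z \<notin> I; x \<noteq> y; x \<noteq> z; y \<noteq> z; insert x I \<in> \<Delta>;
      insert y (insert z I) \<in> \<Delta>\<rbrakk> \<Longrightarrow> insert y (insert x I) \<in> \<Delta> \<or> insert z (insert x I) \<in> \<Delta>"
    and "S \<in> \<Delta>" "T \<in> \<Delta>" "card S < card T"
  shows "\<exists>y\<in>T - S. insert y S \<in> \<Delta>"
  using assms(4,6)
proof (induction "card (S - T)" arbitrary: S rule: less_induct)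
  case less
  have finS: "finite S" and finT: "finite T"
    using fin less.prems(1) \<open>T \<in> \<Delta>\<close> by auto
  show ?case
  proof (cases "S \<subseteq> T")
    case True
    moreover have "S \<noteq> T"
      using less.prems(2) by blast
    ultimately obtain y where y: "y \<in> T - S" by blast
    then have "insert y S \<in> \<Delta>"
      using True down[OF \<open>T \<in> \<Delta>\<close>] by auto
    with y show ?thesis ..
  next
    case False
    then obtain x where x: "x \<in> S" "x \<notin> T" by blast
    define I where "I = S - {x}"
    have I: "insert x I = S" "x \<notin> I" "I \<in> \<Delta>"
      using x down[OF less.prems(1), of I] by (auto simp: I_def)
    \<comment> \<open>The measure drops since x is in S - T but not in I. Adding elements of T
      leaves it unchanged, so induction applies to I and to I + y.\<close>
    have smaller: "card (J - T) < card (S - T)" if "J - T \<subseteq> I - T" for J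
      using that x finS by (intro psubset_card_mono) (auto simp: I_def)
    have cardI: "card S = Suc (card I)"
      using x finS unfolding I_def by (simp only: card_Suc_Diff1)
    obtain y where y: "y \<in> T" "y \<notin> I" "insert y I \<in> \<Delta>"
      using less.hyps[of I] smaller[of I] I(3) cardI less.prems(2) by auto
    \<comment> \<open>I + y has the size of S, so a second augmentation from T is possible.\<close>
    have "card (insert y I) < card T"
      using y finS cardI less.prems(2) by (simp add: I_def)
    moreover have "card (insert y I - T) < card (S - T)"
      using y by (intro smaller) auto
    ultimately obtain z where z: "z \<in> T" "z \<noteq> y" "z \<notin> I" "insert z (insert y I) \<in> \<Delta>"
      using less.hyps[of "insert y I"] y(3) by auto
    have "x \<noteq> y" "x \<noteq> z"
      using x y z by auto
    \<comment> \<open>Local exchange between S = I + x and the face I + y + z augments S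
      itself.\<close>
    then have "insert z S \<in> \<Delta> \<or> insert y S \<in> \<Delta>"
      using exch[of x I z y] I y z less.prems(1) by auto
    moreover have "y \<in> T - S" "z \<in> T - S"
      using y z x I(1) by auto
    ultimately show ?thesis by blast
  qed
qed

theorem theorem4p9:
  fixes X :: "'a set" and \<Delta> :: "'a set set" and n :: nat
  assumes "finite X" and "card X = n"
    and "simplicial_complex X \<Delta>"
    and "\<And>k::nat. 1 \<le> k \<Longrightarrow> k < rk \<Delta> \<Longrightarrow> \<forall>p\<in>atlas_vertices X k. hyperbolic_vertex X \<Delta> p"
  shows "\<forall>S\<in>\<Delta>. \<forall>T\<in>\<Delta>. card S < card T \<longrightarrow> (\<exists>y\<in>T - S. S \<union> {y} \<in> \<Delta>)"
proof (intro ballI impI)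
  fix S T assume ST: "S \<in> \<Delta>" "T \<in> \<Delta>" "card S < card T"
  have "finite U" if "U \<in> \<Delta>" for U
    using assms(1,3) that unfolding simplicial_complex_def by (meson PowD finite_subset subsetD)
  then have "\<exists>y\<in>T - S. insert y S \<in> \<Delta>"
    using simplicial_complex_subset[OF assms(3)] local_exchange[OF assms(1,3,4)] ST
    by (rule exchange_if_local_exchange)
  then show "\<exists>y\<in>T - S. S \<union> {y} \<in> \<Delta>" by simp
qed

end
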